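(* If $G$ and $H$ are non-trivial connected graphs and $\gamma_{r2}(H)\ge 4$, then \[\gamma_{r2}(G\circ H)=2\gamma_t(G).\]
   Context: All graphs are finite and simple; non-trivial means at least two vertices. A $2$-rainbow dominating function of a graph $X$ is a map $f\colon V(X)\to 2^{\{1,2\}}$ such that for every vertex $v$ with $f(v)=\emptyset$ we have $\bigcup_{u\in N(v)} f(u)=\{1,2\}$; its weight is $\sum_v |f(v)|$, and $\gamma_{r2}(X)$ is the minimum weight of such a function. The lexicographic product $G\circ H$ has vertex set $V(G)\times V(H)$, with $(g_1,h_1)$ adjacent to $(g_2,h_2)$ iff $g_1g_2\in E(G)$, or $g_1=g_2$ and $h_1h_2\in E(H)$. $\gamma_t(G)$ is the total domination number of $G$: the minimum size of a set $S\subseteq V(G)$ such that every vertex of $G$ has a neighbor in $S$. *)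

theory Defs
  imports "Graph_Theory.Graph_Theory"
begin

text \<open>
  A finite simple graph is a \<open>pair_graph\<close>: a finite vertex set with a symmetric, irreflexive
  set of ordered pairs, each edge being represented by both of its orientations.
\<close>

definition neighborhood :: "'a pair_pre_digraph \<Rightarrow> 'a \<Rightarrow> 'a set" where
  "neighborhood G v = {u \<in> pverts G. (v, u) \<in> parcs G}"

text \<open>Only the values of \<open>f\<close> on the vertices of \<open>G\<close> matter, both here and for the weight.\<close>

definition rainbow2_dominating :: "'a pair_pre_digraph \<Rightarrow> ('a \<Rightarrow> nat set) \<Rightarrow> bool" where
  "rainbow2_dominating G f \<longleftrightarrow>
     (\<forall>v \<in> pverts G. f v \<subseteq> {1, 2}) \<and>
     (\<forall>v \<in> pverts G. f v = {} \<longrightarrow> (\<Union>u \<in> neighborhood G v. f u) = {1, 2})"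

definition rainbow_weight :: "'a pair_pre_digraph \<Rightarrow> ('a \<Rightarrow> nat set) \<Rightarrow> nat" where
  "rainbow_weight G f = (\<Sum>v \<in> pverts G. card (f v))"

definition rainbow2_domination_number :: "'a pair_pre_digraph \<Rightarrow> nat" where
  "rainbow2_domination_number G =
     (LEAST w. \<exists>f. rainbow2_dominating G f \<and> rainbow_weight G f = w)"

definition total_dominating :: "'a pair_pre_digraph \<Rightarrow> 'a set \<Rightarrow> bool" where
  "total_dominating G S \<longleftrightarrow> S \<subseteq> pverts G \<and> (\<forall>v \<in> pverts G. neighborhood G v \<inter> S \<noteq> {})"

text \<open>Meaningful only for graphs without isolated vertices, where \<open>pverts G\<close> is total dominating.\<close>

definition total_domination_number :: "'a pair_pre_digraph \<Rightarrow> nat" where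
  "total_domination_number G = (LEAST n. \<exists>S. total_dominating G S \<and> card S = n)"

definition lexicographic_product ::
  "'a pair_pre_digraph \<Rightarrow> 'b pair_pre_digraph \<Rightarrow> ('a \<times> 'b) pair_pre_digraph" where
  "lexicographic_product G H =
     \<lparr> pverts = pverts G \<times> pverts H,
       parcs = {((g1, h1), (g2, h2)) | g1 h1 g2 h2.
         g1 \<in> pverts G \<and> h1 \<in> pverts H \<and> g2 \<in> pverts G \<and> h2 \<in> pverts H \<and>
         ((g1, g2) \<in> parcs G \<or> g1 = g2 \<and> (h1, h2) \<in> parcs H)} \<rparr>"

lemma pair_graph_lexicographic_product:
  assumes "pair_graph G" and "pair_graph H"
  shows "pair_graph (lexicographic_product G H)"
proof -
  interpret G: pair_graph G by fact
  interpret H: pair_graph H by fact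
  let ?P = "lexicographic_product G H"
  have sub: "parcs ?P \<subseteq> pverts ?P \<times> pverts ?P"
    by (auto simp: lexicographic_product_def)
  have fin: "finite (pverts ?P)"
    by (simp add: lexicographic_product_def)
  have loop: "e \<in> parcs ?P \<Longrightarrow> fst e \<noteq> snd e" for e
    using G.no_loops H.no_loops by (fastforce simp: lexicographic_product_def)
  have "sym (parcs ?P)"
    using G.arcs_symmetric H.arcs_symmetric
    unfolding sym_def lexicographic_product_def by fastforce
  then have sym: "symmetric (with_proj ?P)"
    by (simp add: symmetric_def arcs_ends_def arc_to_ends_def)
  show ?thesis
  proof unfold_locales
    show "fst e \<in> pverts ?P" if "e \<in> parcs ?P" for e using sub that by auto
    show "snd e \<in> pverts ?P" if "e \<in> parcs ?P" for e using sub that by auto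
    show "finite (parcs ?P)" using sub fin by (meson finite_SigmaI finite_subset)
  qed (fact fin loop sym)+
qed

lemma rainbow2_domination_number_attained:
  "\<exists>f. rainbow2_dominating G f \<and> rainbow_weight G f = rainbow2_domination_number G"
proof -
  have "rainbow2_dominating G (\<lambda>_. {1, 2})"
    by (simp add: rainbow2_dominating_def)
  then show ?thesis
    unfolding rainbow2_domination_number_def
    using LeastI_ex[of "\<lambda>w. \<exists>f. rainbow2_dominating G f \<and> rainbow_weight G f = w"] by blast
qed

lemma total_domination_number_attained:
  assumes "\<And>v. v \<in> pverts G \<Longrightarrow> neighborhood G v \<noteq> {}"
  shows "\<exists>S. total_dominating G S \<and> card S = total_domination_number G"
proof -
  have "total_dominating G (pverts G)"
    using assms by (auto simp: total_dominating_def neighborhood_def)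
  then show ?thesis
    unfolding total_domination_number_def
    using LeastI_ex[of "\<lambda>n. \<exists>S. total_dominating G S \<and> card S = n"] by blast
qed

end

theory Submission
  imports Defs
begin

text \<open>
  For the lower bound, let \<open>f\<close> be a rainbow dominating function on the product. At a vertex \<open>g\<close>
  of \<open>G\<close>, the weight of the layer over \<open>g\<close> is at least the number of colours it contains plus the
  number of colours missing from the layers over the neighbours of \<open>g\<close>. For each colour \<open>c\<close>, take the
  vertices whose layer contains \<open>c\<close>, together with one neighbour of each \<open>g\<close> that misses \<open>c\<close> in its
  neighbourhood: these two sets are total dominating, and their cardinalities sum to at most the
  weight of \<open>f\<close>.
\<close>

lemma rainbow2_domination_number_le:
  "rainbow2_dominating G f \<Longrightarrow> rainbow2_domination_number G \<le> rainbow_weight G f"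
  unfolding rainbow2_domination_number_def by (rule Least_le) blast

lemma total_domination_number_le:
  "total_dominating G S \<Longrightarrow> total_domination_number G \<le> card S"
  unfolding total_domination_number_def by (rule Least_le) blast

lemma neighborhood_subset: "neighborhood G v \<subseteq> pverts G"
  by (auto simp: neighborhood_def)

lemma neighborhood_lexicographic_product:
  assumes "pair_wf_digraph G" and "pair_wf_digraph H" and "g \<in> pverts G" and "h \<in> pverts H"
  shows "neighborhood (lexicographic_product G H) (g, h) =
    neighborhood G g \<times> pverts H \<union> {g} \<times> neighborhood H h"
  using assms by (auto simp: neighborhood_def lexicographic_product_def)

text \<open>A second vertex is reachable from \<open>v\<close>, so a walk leaves \<open>v\<close>,
  and its first arc leads to a neighbour. This makes total domination of \<open>G\<close>
  possible.\<close>

lemma neighborhood_nonempty: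
  assumes "pair_graph G" and "connected (with_proj G)" and "card (pverts G) \<ge> 2"
    and v: "v \<in> pverts G"
  shows "neighborhood G v \<noteq> {}"
proof -
  interpret pair_graph G by fact
  obtain w where w: "w \<in> pverts G" "w \<noteq> v"
    using assms(3) by (metis card_le_Suc0_iff_eq finite_verts not_less_eq_eq numeral_2_eq_2
        with_proj_simps(1))
  have "v \<rightarrow>\<^sup>*\<^bsub>mk_symmetric (with_proj G)\<^esub> w"
    using assms(2) v w(1) by (auto simp: connected_def)
  then obtain u where "(v, u) \<in> parcs (mk_symmetric (with_proj G))"
    using w(2) by (cases rule: pre_digraph.converse_reachable_cases) auto
  then have "(v, u) \<in> parcs G"
    using arcs_symmetric by (auto simp: parcs_mk_symmetric)
  then show ?thesis
    using in_arcsD2 by (auto simp: neighborhood_def)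
qed

text \<open>Double counting of the pairs (v, c) with c in \<open>X v\<close>. It converts weights
  summed over vertices into sizes of colour classes.\<close>

lemma sum_card_eq_sum_card_colour:
  assumes "finite V" and "finite K" and "\<And>v. v \<in> V \<Longrightarrow> X v \<subseteq> K"
  shows "(\<Sum>v\<in>V. card (X v)) = (\<Sum>c\<in>K. card {v \<in> V. c \<in> X v})"
proof -
  have "(\<Sum>v\<in>V. card (X v)) = (\<Sum>v\<in>V. \<Sum>c\<in>K. if c \<in> X v then 1 else 0)"
  proof (rule sum.cong)
    fix v assume "v \<in> V"
    then have "X v = {c \<in> K. c \<in> X v}" using assms(3) by auto
    then show "card (X v) = (\<Sum>c\<in>K. if c \<in> X v then 1 else 0)"
      using assms(2) by (simp add: sum.If_cases Int_def)
  qed simp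
  also have "\<dots> = (\<Sum>c\<in>K. \<Sum>v\<in>V. if c \<in> X v then 1 else 0)"
    by (rule sum.swap)
  also have "\<dots> = (\<Sum>c\<in>K. card {v \<in> V. c \<in> X v})"
    using assms(1) by (simp add: sum.If_cases Int_def)
  finally show ?thesis .
qed

text \<open>
  Here \<open>F\<close> is the restriction of a rainbow dominating function to a layer, and \<open>C\<close> is the set of
  colours occurring in the neighbouring layers. If exactly one colour \<open>i\<close> is absent from \<open>C\<close>, then
  assigning both colours to every vertex carrying \<open>i\<close> yields a rainbow dominating function of \<open>H\<close>.
\<close>

lemma layer_weight_ge:
  fixes F :: "'b \<Rightarrow> nat set"
  assumes fin: "finite (pverts H)" and num: "rainbow2_domination_number H \<ge> 4"
    and F: "\<And>h. h \<in> pverts H \<Longrightarrow> F h \<subseteq> {1, 2}" and C: "C \<subseteq> {1, 2}"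
    and dom: "\<And>h. h \<in> pverts H \<Longrightarrow> F h = {} \<Longrightarrow> (\<Union>u \<in> neighborhood H h. F u) \<union> C = {1, 2}"
  shows "card (\<Union>h \<in> pverts H. F h) + card ({1, 2} - C) \<le> rainbow_weight H F"
proof -
  let ?U = "\<Union>h \<in> pverts H. F h"
  have U: "?U \<subseteq> {1, 2}" using F by blast
  then have cardU: "card ?U \<le> 2" using card_mono[OF _ U] by simp
  consider "C = {1, 2}" | "C = {}" | i j where "C = {j}" "{1, 2} = {i, j}" "i \<noteq> j"
  proof -
    have "C = {} \<or> C = {1} \<or> C = {2} \<or> C = {1, 2}" using C by blast
    then show thesis using that(1,2) that(3)[of 2 1] that(3)[of 1 2] by (auto simp: insert_commute)
  qed
  then show ?thesis
  proof cases
    case 1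
    then show ?thesis using card_UN_le[OF fin, of F] by (simp add: rainbow_weight_def)
  next
    \<comment> \<open>Without help from neighbouring layers, \<open>F\<close> itself dominates
      \<open>H\<close>, so the weight is at least 4 = 2 + 2.\<close>
    case 2
    then have "rainbow2_dominating H F" using F dom by (simp add: rainbow2_dominating_def)
    then have "4 \<le> rainbow_weight H F" using rainbow2_domination_number_le num le_trans by blast
    then show ?thesis using 2 cardU by simp
  next
    case 3
    define F' where "F' = (\<lambda>h. if i \<in> F h then {i, j} else F h)"
    define n where "n k = card {h \<in> pverts H. k \<in> F h}" for k
    have "rainbow2_dominating H F'"
      unfolding rainbow2_dominating_def
    proof (intro conjI ballI impI)
      fix h assume h: "h \<in> pverts H"
      show "F' h \<subseteq> {1, 2}" using F[OF h] 3 by (auto simp: F'_def)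
      assume "F' h = {}"
      then have "F h = {}" by (auto simp: F'_def split: if_splits)
      \<comment> \<open>Since \<open>C\<close> is {j}, the colour \<open>i\<close> must reach
        \<open>h\<close> from within its own layer, and there \<open>F'\<close> supplies both
        colours.\<close>
      then obtain u where u: "u \<in> neighborhood H h" "i \<in> F u"
        using dom[OF h] 3 by blast
      have "F' v \<subseteq> {i, j}" if "v \<in> neighborhood H h" for v
        using F[of v] that neighborhood_subset[of H h] 3 by (auto simp: F'_def)
      with u show "(\<Union>u \<in> neighborhood H h. F' u) = {1, 2}"
        unfolding 3 by (force simp: F'_def)
    qed
    then have "4 \<le> rainbow_weight H F'" using rainbow2_domination_number_le num le_trans by blast
    also have "rainbow_weight H F' = (\<Sum>c\<in>{i, j}. card {v \<in> pverts H. c \<in> F' v})"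
      unfolding rainbow_weight_def using F 3
      by (intro sum_card_eq_sum_card_colour fin) (auto simp: F'_def)
    \<comment> \<open>\<open>F'\<close> keeps the class of \<open>i\<close> and enlarges the class
      of \<open>j\<close> to the union of both classes.\<close>
    also have "\<dots> = n i + card ({h \<in> pverts H. i \<in> F h} \<union> {h \<in> pverts H. j \<in> F h})"
      using \<open>i \<noteq> j\<close> by (auto simp: F'_def n_def intro!: arg_cong[of _ _ card] arg_cong2[of _ _ _ _ "(+)"])
    also have "\<dots> \<le> 2 * n i + n j"
      using card_Un_le[of "{h \<in> pverts H. i \<in> F h}" "{h \<in> pverts H. j \<in> F h}"]
      by (simp add: n_def)
    finally have four: "4 \<le> 2 * n i + n j" .
    have weight: "rainbow_weight H F = n i + n j"
      unfolding rainbow_weight_def n_def using F 3 sum_card_eq_sum_card_colour[OF fin, of "{i, j}" F]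
      by simp
    have one: "card ?U \<le> 1" if "n i = 0 \<or> n j = 0"
    proof -
      from that fin have "?U \<subseteq> {j} \<or> ?U \<subseteq> {i}"
        using U 3 by (auto simp: n_def)
      then show ?thesis by (metis card.empty card_1_singleton_iff One_nat_def le_refl
            subset_singletonD zero_le)
    qed
    have "{1, 2} - C = {i}" using 3 by auto
    then have "card ({1, 2} - C) = 1" by simp
    \<comment> \<open>If both classes are nonempty, \<open>four\<close> excludes \<open>n i\<close>
      = \<open>n j\<close> = 1, so the weight is at least 3 = 2 + 1. If one is empty,
      \<open>four\<close> makes the other have size at least 2 = 1 + 1.\<close>
    then show ?thesis using four weight one cardU by linarith
  qed
qed

text \<open>Both colours are placed on a single copy of \<open>S\<close>, at a fixed height
  \<open>h0\<close>. An edge from g to s in \<open>G\<close> joins the whole layer over g to (s,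
  \<open>h0\<close>).\<close>

lemma rainbow2_domination_number_lexicographic_product_le:
  assumes G: "pair_graph G" and H: "pair_graph H" and "pverts H \<noteq> {}"
    and S: "total_dominating G S"
  shows "rainbow2_domination_number (lexicographic_product G H) \<le> 2 * card S"
proof -
  interpret G: pair_graph G by fact
  interpret H: pair_graph H by fact
  let ?P = "lexicographic_product G H"
  obtain h0 where h0: "h0 \<in> pverts H" using assms(3) by blast
  define f :: "'a \<times> 'b \<Rightarrow> nat set" where "f = (\<lambda>v. if v \<in> S \<times> {h0} then {1, 2} else {})"
  have "rainbow2_dominating ?P f"
    unfolding rainbow2_dominating_def
  proof (intro conjI ballI impI)
    fix v assume "v \<in> pverts ?P"
    then obtain g h where v: "v = (g, h)" "g \<in> pverts G" "h \<in> pverts H"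
      by (auto simp: lexicographic_product_def)
    then obtain s where s: "s \<in> neighborhood G g" "s \<in> S"
      using S by (auto simp: total_dominating_def)
    then have "(s, h0) \<in> neighborhood ?P v"
      using v h0 by (simp add: neighborhood_lexicographic_product G.pair_wf_digraph_axioms
          H.pair_wf_digraph_axioms)
    moreover have "f (s, h0) = {1, 2}" using s by (simp add: f_def)
    moreover have "f u \<subseteq> {1, 2}" for u by (simp add: f_def)
    ultimately show "(\<Union>u \<in> neighborhood ?P v. f u) = {1, 2}" by blast
  qed (simp add: f_def)
  then have "rainbow2_domination_number ?P \<le> rainbow_weight ?P f"
    by (rule rainbow2_domination_number_le)
  also have "\<dots> = (\<Sum>v \<in> pverts ?P. if v \<in> S \<times> {h0} then 2 else 0)"
    unfolding rainbow_weight_def by (intro sum.cong) (auto simp: f_def)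
  also have "\<dots> = 2 * card (pverts ?P \<inter> S \<times> {h0})"
    by (simp add: sum.If_cases lexicographic_product_def)
  also have "pverts ?P \<inter> S \<times> {h0} = S \<times> {h0}"
    using S h0 by (auto simp: total_dominating_def lexicographic_product_def)
  finally show ?thesis by (simp add: card_cartesian_product)
qed

lemma total_domination_number_le_rainbow_weight:
  assumes G: "pair_graph G" and H: "pair_graph H"
    and nonempty: "\<And>g. g \<in> pverts G \<Longrightarrow> neighborhood G g \<noteq> {}"
    and num: "rainbow2_domination_number H \<ge> 4"
    and f: "rainbow2_dominating (lexicographic_product G H) f"
  shows "2 * total_domination_number G \<le> rainbow_weight (lexicographic_product G H) f"
proof -
  interpret G: pair_graph G by fact
  interpret H: pair_graph H by fact
  let ?P = "lexicographic_product G H"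
  have vertsP: "pverts ?P = pverts G \<times> pverts H" by (simp add: lexicographic_product_def)
  have finG: "finite (pverts G)" and finH: "finite (pverts H)"
    using G.finite_verts H.finite_verts by auto
  define colours where "colours g = (\<Union>h \<in> pverts H. f (g, h))" for g
  define missing where "missing g = {1, 2} - (\<Union>u \<in> neighborhood G g. colours u)" for g
  \<comment> \<open>Adding one chosen neighbour per vertex, rather than all of them, bounds the size
    of the image by the number of vertices missing the colour.\<close>
  define pick where "pick g = (SOME u. u \<in> neighborhood G g)" for g
  define S where "S c = {g \<in> pverts G. c \<in> colours g} \<union> pick ` {g \<in> pverts G. c \<in> missing g}" for c
  have pick: "pick g \<in> neighborhood G g" if "g \<in> pverts G" for g
    unfolding pick_def using nonempty[OF that] by (simp add: some_in_eq)
  have colours: "colours g \<subseteq> {1, 2}" if "g \<in> pverts G" for g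
    using f that by (auto simp: rainbow2_dominating_def colours_def vertsP)
  have total: "total_dominating G (S c)" if c: "c \<in> {1, 2}" for c
    unfolding total_dominating_def
  proof (intro conjI ballI)
    show "S c \<subseteq> pverts G" using pick by (auto simp: S_def neighborhood_def)
  next
    fix g assume g: "g \<in> pverts G"
    show "neighborhood G g \<inter> S c \<noteq> {}"
    proof (cases "c \<in> missing g")
      case True
      then show ?thesis using pick[OF g] g by (auto simp: S_def)
    next
      case False
      \<comment> \<open>A colour not missing at \<open>g\<close> occurs in the layer over some
        neighbour of \<open>g\<close>, which then lies in \<open>S c\<close>.\<close>
      then show ?thesis using c neighborhood_subset[of G g] by (auto simp: S_def missing_def)
    qed
  qed
  have layer: "card (colours g) + card (missing g) \<le> rainbow_weight H (\<lambda>h. f (g, h))"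
    if g: "g \<in> pverts G" for g
    unfolding colours_def missing_def
  proof (rule layer_weight_ge[OF finH num], unfold colours_def[symmetric])
    show "f (g, h) \<subseteq> {1, 2}" if "h \<in> pverts H" for h
      using f g that by (auto simp: rainbow2_dominating_def vertsP)
    show "(\<Union>u \<in> neighborhood G g. colours u) \<subseteq> {1, 2}"
      using colours neighborhood_subset[of G g] by blast
    show "(\<Union>u \<in> neighborhood H h. f (g, u)) \<union> (\<Union>u \<in> neighborhood G g. colours u) = {1, 2}"
      if h: "h \<in> pverts H" and "f (g, h) = {}" for h
    proof -
      \<comment> \<open>The neighbours of (g, h) are those inside its own layer and all vertices of
        the neighbouring layers. The latter contribute exactly the colours playing the role of
        \<open>C\<close>.\<close>
      have "(\<Union>u \<in> neighborhood ?P (g, h). f u) = {1, 2}"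
        using f g that by (simp add: rainbow2_dominating_def vertsP)
      then show ?thesis
        using g h by (simp add: neighborhood_lexicographic_product G.pair_wf_digraph_axioms
            H.pair_wf_digraph_axioms colours_def UN_Un Sup_set_def Un_commute) blast
    qed
  qed
  have "2 * total_domination_number G = (\<Sum>c\<in>{1, 2::nat}. total_domination_number G)"
    by simp
  also have "\<dots> \<le> (\<Sum>c\<in>{1, 2}. card (S c))"
    by (intro sum_mono total_domination_number_le total)
  also have "\<dots> \<le> (\<Sum>c\<in>{1, 2}. card {g \<in> pverts G. c \<in> colours g} + card {g \<in> pverts G. c \<in> missing g})"
    unfolding S_def
    by (intro sum_mono order_trans[OF card_Un_le] add_left_mono card_image_le) (simp add: finG)
  \<comment> \<open>Double counting turns both families of colour classes back into sums over the
    vertices of \<open>G\<close>, where the layer bound applies.\<close>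
  also have "\<dots> = (\<Sum>g\<in>pverts G. card (colours g)) + (\<Sum>g\<in>pverts G. card (missing g))"
    using colours by (subst (1 2) sum_card_eq_sum_card_colour[OF finG, of "{1, 2}"])
      (auto simp: missing_def sum.distrib)
  also have "\<dots> \<le> (\<Sum>g\<in>pverts G. rainbow_weight H (\<lambda>h. f (g, h)))"
    unfolding sum.distrib[symmetric] by (intro sum_mono layer)
  also have "\<dots> = rainbow_weight ?P f"
    by (simp add: rainbow_weight_def vertsP sum.cartesian_product)
  finally show ?thesis .
qed

theorem theorem11:
  fixes G :: "'a pair_pre_digraph" and H :: "'b pair_pre_digraph"
  assumes "pair_graph G" and "connected (with_proj G)" and "card (pverts G) \<ge> 2"
    and "pair_graph H" and "connected (with_proj H)" and "card (pverts H) \<ge> 2"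
    and "rainbow2_domination_number H \<ge> 4"
  shows "rainbow2_domination_number (lexicographic_product G H) = 2 * total_domination_number G"
proof (rule antisym)
  note nonempty = neighborhood_nonempty[OF assms(1-3)]
  obtain S where "total_dominating G S" "card S = total_domination_number G"
    using total_domination_number_attained[OF nonempty] by blast
  moreover have "pverts H \<noteq> {}" using assms(6) by auto
  ultimately show "rainbow2_domination_number (lexicographic_product G H) \<le> 2 * total_domination_number G"
    using rainbow2_domination_number_lexicographic_product_le[OF assms(1,4)] by metis
  show "2 * total_domination_number G \<le> rainbow2_domination_number (lexicographic_product G H)"
    using total_domination_number_le_rainbow_weight[OF assms(1,4) nonempty assms(7)]
      rainbow2_domination_number_attained by metis
qed

end
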